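(* Let $m>s>n\ge1$ be integers, let $A\in\mathbb{R}^{m\times n}$ have linearly independent columns, let $S\in\mathbb{R}^{s\times m}$ have linearly independent rows, and assume $SA$ has full column rank. Let $A=Q_AR_A$ and $SA=QR$ be economized QR factorizations. Assume $$\kappa_2(SQ_A)<49,\qquad n^2u<\tfrac{1}{201},\qquad \frac{m}{n}+\sqrt n>200,$$ and $$\kappa_2(A)<\frac{1}{3C_1k(S)},$$ where $$C_1=\sqrt{sn}\,\gamma_m+\sqrt n\,\tilde\gamma_{sn}\,(1+\sqrt{sn}\,\gamma_m),\qquad k(S)=\|S\|_2\,\|(SQ_A)^\dagger\|_2 .$$ In floating-point arithmetic with unit round-off $u$, compute $\hat B$ from the matrix product $SA$, compute the upper triangular factor $\hat R$ of $\hat B$ by the Householder QR algorithm, and compute $\hat Y$ from $A\hat R^{-1}$ by forward substitution. Then $$\kappa_2(\hat Y)\le 4\,\kappa_2(SQ_A)+1.$$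
   Context: Notation: $\|\cdot\|_2$ is the spectral norm, $\|\cdot\|_F$ the Frobenius norm, $M^\dagger$ the Moore–Penrose pseudoinverse, $\kappa_2(M)=\sigma_{\max}(M)/\sigma_{\min}(M)$, and $|M|$ the entrywise absolute value (inequalities between such matrices are entrywise). An economized QR factorization of a full-column-rank $m\times n$ matrix is $QR$ with $Q\in\mathbb{R}^{m\times n}$ having orthonormal columns and $R\in\mathbb{R}^{n\times n}$ upper triangular. Rounding constants: $u>0$ is the unit round-off, $\gamma_k=\frac{ku}{1-ku}$ and $\tilde\gamma_{k}=\frac{cku}{1-cku}$, where $c\ge1$ is a fixed small integer constant (coming from the error analysis of Householder QR); it is implicitly assumed that all denominators are positive, i.e. $mu<1$ and $csnu<1$. (Thus $C_1=\mathcal{O}((\sqrt{sn}\,m+sn^{3/2})u)$.) Floating-point model (the meaning of "computed"): (1) Matrix product: $\hat B=SA+E_1$ with $\|E_1\|_2\le\gamma_m\sqrt{sn}\,\|S\|_2\|A\|_2$. (2) Householder QR: $\hat R\in\mathbb{R}^{n\times n}$ is upper triangular and there is $\tilde Q\in\mathbb{R}^{s\times n}$ with orthonormal columns such that $\tilde Q\hat R=\hat B+E_2$ with $\|E_2\|_F\le\tilde\gamma_{sn}\|\hat B\|_F$. (3) Forward substitution: with $a_i^T$ and $\hat y_i^T$ the $i$th rows of $A$ and $\hat Y$, for each $i$ there is $\Delta_i\in\mathbb{R}^{n\times n}$ with $\hat y_i^T(\hat R+\Delta_i)=a_i^T$ and $|\Delta_i|\le\gamma_n|\hat R|$. Consequently,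 when $\sqrt n\gamma_n\kappa_2(\hat R)<1$, $\|\hat Y-A\hat R^{-1}\|_F\le\frac{\sqrt n\gamma_n\kappa_2(\hat R)}{1-\sqrt n\gamma_n\kappa_2(\hat R)}\|A\hat R^{-1}\|_F$. *)

theory Defs
  imports "HOL-Analysis.Analysis"
begin

text \<open>
  A matrix with p rows and q columns is a term of type \<^typ>\<open>real^'q^'p\<close>.
  The type class norm on this type is the Frobenius norm.  The index type of
  the columns of a triangular factor carries a linear order, so that it is a
  copy of the ordered set of indices from 1 to n.
\<close>

definition spectral_norm :: "real^'q^'p \<Rightarrow> real" where
  "spectral_norm M = onorm (\<lambda>x. M *v x)"

abbreviation frobenius_norm :: "real^'q^'p \<Rightarrow> real" where
  "frobenius_norm M \<equiv> norm M"

text \<open>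
  Requiring both singular vectors to be nonzero gives the min(p,q) usual
  singular values for every shape: zero is one of them iff the rank is less than min(p,q).
\<close>

definition singular_values :: "real^'q^'p \<Rightarrow> real set" where
  "singular_values M = {\<sigma>. \<sigma> \<ge> 0 \<and>
     (\<exists>v w. norm v = 1 \<and> norm w = 1 \<and> M *v v = \<sigma> *\<^sub>R w \<and> transpose M *v w = \<sigma> *\<^sub>R v)}"

definition sigma_max :: "real^'q^'p \<Rightarrow> real" where
  "sigma_max M = Max (singular_values M)"

definition sigma_min :: "real^'q^'p \<Rightarrow> real" where
  "sigma_min M = Min (singular_values M)"

text \<open>
  Extended-real valued: a rank-deficient matrix has condition number \<open>\<infinity>\<close>, instead
  of the value 0 that division by zero in \<^typ>\<open>real\<close> would give.  An upper bound by a
  finite number therefore includes the claim of full rank.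
\<close>

definition cond2 :: "real^'q^'p \<Rightarrow> ereal" where
  "cond2 M = (if sigma_min M = 0 then \<infinity> else ereal (sigma_max M / sigma_min M))"

definition is_pseudoinverse :: "real^'q^'p \<Rightarrow> real^'p^'q \<Rightarrow> bool" where
  "is_pseudoinverse M X \<longleftrightarrow>
     M ** X ** M = M \<and> X ** M ** X = X \<and>
     transpose (M ** X) = M ** X \<and> transpose (X ** M) = X ** M"

definition pseudoinverse :: "real^'q^'p \<Rightarrow> real^'p^'q" where
  "pseudoinverse M = (THE X. is_pseudoinverse M X)"

definition lin_indep_columns :: "real^'q^'p \<Rightarrow> bool" where
  "lin_indep_columns M \<longleftrightarrow>
     (\<forall>c. (\<Sum>j\<in>UNIV. c j *s column j M) = 0 \<longrightarrow> (\<forall>j. c j = 0))"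

definition lin_indep_rows :: "real^'q^'p \<Rightarrow> bool" where
  "lin_indep_rows M \<longleftrightarrow>
     (\<forall>c. (\<Sum>i\<in>UNIV. c i *s row i M) = 0 \<longrightarrow> (\<forall>i. c i = 0))"

definition orthonormal_columns :: "real^'q^'p \<Rightarrow> bool" where
  "orthonormal_columns Q \<longleftrightarrow> transpose Q ** Q = mat 1"

definition upper_triangular :: "real^('n::{finite,linorder})^('n::{finite,linorder}) \<Rightarrow> bool" where
  "upper_triangular R \<longleftrightarrow> (\<forall>i j. j < i \<longrightarrow> R $ i $ j = 0)"

definition economized_QR ::
  "real^('n::{finite,linorder})^'p \<Rightarrow> real^('n::{finite,linorder})^'p \<Rightarrow> real^('n::{finite,linorder})^('n::{finite,linorder}) \<Rightarrow> bool" where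
  "economized_QR M Q R \<longleftrightarrow> orthonormal_columns Q \<and> upper_triangular R \<and> M = Q ** R"

definition gam :: "real \<Rightarrow> nat \<Rightarrow> real" where
  "gam u k = real k * u / (1 - real k * u)"

definition gam_tilde :: "nat \<Rightarrow> real \<Rightarrow> nat \<Rightarrow> real" where
  "gam_tilde c u k = real c * real k * u / (1 - real c * real k * u)"

definition C1 :: "nat \<Rightarrow> real \<Rightarrow> nat \<Rightarrow> nat \<Rightarrow> nat \<Rightarrow> real" where
  "C1 c u m s n =
     sqrt (real (s * n)) * gam u m
     + sqrt (real n) * gam_tilde c u (s * n) * (1 + sqrt (real (s * n)) * gam u m)"

definition k_sketch :: "real^'m^'s \<Rightarrow> real^'n^'m \<Rightarrow> real" where
  "k_sketch S QA = spectral_norm S * spectral_norm (pseudoinverse (S ** QA))"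

text \<open>
  Floating-point model.  Each predicate says that its last argument is an admissible
  computed result, i.e. that it satisfies the backward error bound of the operation.
\<close>

definition computed_product ::
  "real \<Rightarrow> real^'m^'s \<Rightarrow> real^'n^'m \<Rightarrow> real^'n^'s \<Rightarrow> bool" where
  "computed_product u S A Bhat \<longleftrightarrow>
     (\<exists>E1. Bhat = S ** A + E1 \<and>
        spectral_norm E1 \<le> gam u CARD('m) * sqrt (real (CARD('s) * CARD('n)))
                             * spectral_norm S * spectral_norm A)"

definition computed_QR_factor ::
  "nat \<Rightarrow> real \<Rightarrow> real^('n::{finite,linorder})^'s \<Rightarrow> real^('n::{finite,linorder})^('n::{finite,linorder}) \<Rightarrow> bool" where
  "computed_QR_factor c u Bhat Rhat \<longleftrightarrow>
     upper_triangular Rhat \<and>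
     (\<exists>Qt E2. orthonormal_columns (Qt :: real^('n::{finite,linorder})^'s) \<and> Qt ** Rhat = Bhat + E2 \<and>
        frobenius_norm E2 \<le> gam_tilde c u (CARD('s) * CARD('n)) * frobenius_norm Bhat)"

definition computed_forward_substitution ::
  "real \<Rightarrow> real^'n^'m \<Rightarrow> real^'n^'n \<Rightarrow> real^'n^'m \<Rightarrow> bool" where
  "computed_forward_substitution u A Rhat Yhat \<longleftrightarrow>
     (\<forall>i. \<exists>\<Delta> :: real^'n^'n.
        row i Yhat v* (Rhat + \<Delta>) = row i A \<and>
        (\<forall>j k. \<bar>\<Delta> $ j $ k\<bar> \<le> gam u CARD('n) * \<bar>Rhat $ j $ k\<bar>))"

end

theory Submission
  imports Defs
begin

text \<open>
  Write \<open>\<sigma>\<close> for the smallest singular value of \<open>S Q\<^sub>A\<close> and \<open>\<kappa>\<close> for its condition number. The computed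
  factor satisfies \<open>norm (R x) = norm (S A x + E x)\<close> with an accumulated error \<open>E\<close> of spectral norm at
  most \<open>C\<^sub>1 \<parallel>S\<parallel> \<parallel>A\<parallel>\<close>; the bound on the condition number of \<open>A\<close> turns this into
  \<open>norm (E x) \<le> \<sigma> / 3 * norm (A x)\<close>. Hence \<open>norm (R x)\<close> lies between \<open>2/3 * \<sigma> * norm (A x)\<close> and
  \<open>(\<kappa> + 1/3) * \<sigma> * norm (A x)\<close>, that is, the exact preconditioned matrix \<open>Z = A R\<^sup>-\<^sup>1\<close> has condition number
  at most \<open>3/2 * \<kappa> + 1/2\<close>. Since \<open>C\<^sub>1 > 200 n\<^sup>2 u\<close>, the same bound on the condition number of \<open>A\<close> makes
  the relative error of forward substitution at most \<open>\<epsilon> = 0.00337\<close> of the a priori bound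
  \<open>3 / (2 * \<sigma>)\<close> on \<open>\<parallel>Z\<parallel>\<close>, which \<open>\<kappa> < 49\<close> keeps well below the smallest singular value of \<open>Z\<close>.
\<close>

section \<open>Spectral and Frobenius norm estimates\<close>

lemma norm_matrix_vector_le_spectral:
  fixes M :: "real^'q^'p"
  shows "norm (M *v x) \<le> spectral_norm M * norm x"
  unfolding spectral_norm_def by (rule onorm) simp

lemma spectral_norm_le:
  fixes M :: "real^'q^'p"
  assumes "\<And>x. norm (M *v x) \<le> b * norm x"
  shows "spectral_norm M \<le> b"
  unfolding spectral_norm_def by (rule onorm_le) (rule assms)

lemma spectral_norm_nonneg: "0 \<le> spectral_norm (M :: real^'q^'p)"
  unfolding spectral_norm_def by (rule onorm_pos_le) simp

lemma norm_matrix_vector_le_frobenius: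
  fixes M :: "real^'q^'p"
  shows "norm (M *v x) \<le> norm M * norm x"
proof -
  have "norm (M *v x) = L2_set (\<lambda>i. \<bar>(M $ i) \<bullet> x\<bar>) UNIV"
    by (simp add: norm_vec_def matrix_vector_mul_component)
  also have "\<dots> \<le> L2_set (\<lambda>i. norm (M $ i) * norm x) UNIV"
    by (intro L2_set_mono) (auto simp: Cauchy_Schwarz_ineq2)
  also have "\<dots> = norm M * norm x"
    by (simp add: norm_vec_def L2_set_left_distrib)
  finally show ?thesis .
qed

text \<open>A matrix and its transpose share their operator bounds: pairing \<open>v\<close> with
  \<open>M *v ?w\<close> for \<open>?w = v v* M\<close> yields the square of \<open>norm ?w\<close>,
  and one factor \<open>norm ?w\<close> cancels.\<close>

lemma norm_vector_matrix_le:
  fixes M :: "real^'q^'p"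
  assumes "\<And>x. norm (M *v x) \<le> b * norm x"
  shows "norm (v v* M) \<le> b * norm v"
proof -
  let ?w = "v v* M"
  have "norm ?w ^ 2 = v \<bullet> (M *v ?w)"
    by (simp add: power2_norm_eq_inner dot_lmul_matrix)
  also have "\<dots> \<le> norm v * norm (M *v ?w)" by (rule norm_cauchy_schwarz)
  also have "\<dots> \<le> norm v * (b * norm ?w)" by (intro mult_left_mono assms) simp
  finally have *: "norm ?w * norm ?w \<le> (b * norm v) * norm ?w"
    by (simp add: power2_eq_square mult_ac)
  show ?thesis
  proof (cases "norm ?w = 0")
    case True
    have "0 \<le> b * norm v"
    proof (cases "v = 0")
      case False
      \<comment> \<open>The sign of \<open>b\<close> follows from the bound at a nonzero test
        vector.\<close>
      have "0 \<le> b * norm (axis undefined 1 :: real^'q)"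
        using assms[of "axis undefined 1"] norm_ge_zero order_trans by blast
      then show ?thesis by simp
    qed simp
    then show ?thesis using True by simp
  next
    case False
    then show ?thesis using * mult_right_le_imp_le[of "norm ?w" "norm ?w" "b * norm v"] by simp
  qed
qed

text \<open>The squared Frobenius norm is the sum of the squared column norms, and each column is
  the image of a unit vector.\<close>

lemma frobenius_le_sqrt_spectral:
  fixes M :: "real^'q^'p"
  assumes "\<And>x. norm (M *v x) \<le> b * norm x" "0 \<le> b"
  shows "norm M \<le> sqrt (real CARD('q)) * b"
proof -
  have "norm M ^ 2 = (\<Sum>i\<in>UNIV. \<Sum>j\<in>UNIV. (M $ i $ j)\<^sup>2)"
    unfolding power2_norm_eq_inner by (simp add: inner_vec_def power2_eq_square)
  also have "\<dots> = (\<Sum>j\<in>UNIV. \<Sum>i\<in>UNIV. (M $ i $ j)\<^sup>2)" by (rule sum.swap)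
  also have "\<dots> = (\<Sum>j\<in>UNIV. (norm (M *v axis j 1))\<^sup>2)"
    unfolding power2_norm_eq_inner
    by (simp add: matrix_vector_mult_basis inner_vec_def power2_eq_square column_def)
  also have "\<dots> \<le> (\<Sum>j\<in>(UNIV::'q set). b\<^sup>2)"
  proof (intro sum_mono power_mono)
    fix j :: 'q
    show "norm (M *v axis j 1) \<le> b" using assms(1)[of "axis j 1"] by simp
  qed simp
  also have "\<dots> = (sqrt (real CARD('q)) * b)\<^sup>2" by (simp add: power_mult_distrib)
  finally show ?thesis by (rule power2_le_imp_le) (simp add: assms)
qed

section \<open>Singular values and condition numbers through extrema on the unit sphere\<close>

text \<open>The sign of the quadratic form at \<open>v + t *\<^sub>R f v\<close> for small negative \<open>t\<close> forces \<open>f v = 0\<close>.\<close>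

lemma psd_isotropic_imp_kernel:
  fixes f :: "'a::real_inner \<Rightarrow> 'a"
  assumes f: "linear f" and sym: "\<And>x y. x \<bullet> f y = f x \<bullet> y"
    and pos: "\<And>x. 0 \<le> x \<bullet> f x" and v: "v \<bullet> f v = 0"
  shows "f v = 0"
proof -
  interpret linear f by fact
  let ?h = "f v" and ?b = "f v \<bullet> f (f v)"
  have *: "0 \<le> 2 * t * (?h \<bullet> ?h) + t\<^sup>2 * ?b" for t :: real
  proof -
    have "0 \<le> (v + t *\<^sub>R ?h) \<bullet> f (v + t *\<^sub>R ?h)" by (rule pos)
    also have "\<dots> = 2 * t * (?h \<bullet> ?h) + t\<^sup>2 * ?b"
      using v sym[of v ?h] by (simp add: add scale inner_simps power2_eq_square algebra_simps)
    finally show ?thesis .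
  qed
  have b: "0 \<le> ?b" by (rule pos)
  show ?thesis
  proof (cases "?b = 0")
    case True
    then have "?h \<bullet> ?h \<le> 0" using *[of "-1"] by simp
    then show ?thesis by (simp add: order_antisym_conv)
  next
    case False
    then have b: "?b > 0" using b by simp
    \<comment> \<open>The parameter \<open>t = - (?h \<bullet> ?h) / ?b\<close> minimises the
      quadratic in \<open>t\<close>; the minimum is negative unless \<open>?h = 0\<close>.\<close>
    have "0 \<le> - (?h \<bullet> ?h)\<^sup>2 / ?b"
      using *[of "- (?h \<bullet> ?h) / ?b"] b by (simp add: power2_eq_square field_simps)
    then have "(?h \<bullet> ?h)\<^sup>2 \<le> 0" using b by (simp add: field_simps)
    then show ?thesis by simp
  qed
qed

text \<open>Extremality makes the quadratic form of \<open>?c^2\<close> times the identity minus the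
  Gram matrix, or of its negative, positive semidefinite. The form vanishes at \<open>v\<close>, so
  \<open>v\<close> lies in the kernel.\<close>

lemma gram_eigenvector:
  fixes M :: "real^'q^'p"
  assumes "norm v = 1"
    and ext: "(\<forall>x. norm (M *v x) \<le> norm (M *v v) * norm x) \<or>
              (\<forall>x. norm (M *v v) * norm x \<le> norm (M *v x))"
  shows "(M *v v) v* M = (norm (M *v v))\<^sup>2 *\<^sub>R v"
proof -
  let ?c = "norm (M *v v)"
  have lin: "linear (\<lambda>x. (M *v x) v* M)"
    by (simp flip: transpose_matrix_vector add: matrix_vector_mul_assoc)
  have quad: "x \<bullet> ((M *v x) v* M) = (norm (M *v x))\<^sup>2" for x
    by (metis dot_lmul_matrix inner_commute power2_norm_eq_inner)
  have sym: "x \<bullet> ((M *v y) v* M) = ((M *v x) v* M) \<bullet> y" for x y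
    by (metis dot_lmul_matrix inner_commute)
  from ext show ?thesis
  proof
    assume up: "\<forall>x. norm (M *v x) \<le> ?c * norm x"
    have "?c\<^sup>2 *\<^sub>R v - (M *v v) v* M = 0"
    proof (rule psd_isotropic_imp_kernel[where f = "\<lambda>x. ?c\<^sup>2 *\<^sub>R x - (M *v x) v* M"])
      show "linear (\<lambda>x. ?c\<^sup>2 *\<^sub>R x - (M *v x) v* M)"
        by (intro linear_compose_sub lin linear_scaleR)
      show "x \<bullet> (?c\<^sup>2 *\<^sub>R y - (M *v y) v* M) = (?c\<^sup>2 *\<^sub>R x - (M *v x) v* M) \<bullet> y" for x y
        by (simp add: inner_simps sym)
      show "0 \<le> x \<bullet> (?c\<^sup>2 *\<^sub>R x - (M *v x) v* M)" for x
        using power_mono[OF up[rule_format, of x], of 2]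
        by (simp add: inner_simps quad power_mult_distrib power2_norm_eq_inner)
      show "v \<bullet> (?c\<^sup>2 *\<^sub>R v - (M *v v) v* M) = 0"
        using \<open>norm v = 1\<close> by (simp add: inner_simps quad flip: power2_norm_eq_inner)
    qed
    then show ?thesis by simp
  next
    assume lo: "\<forall>x. ?c * norm x \<le> norm (M *v x)"
    have "(M *v v) v* M - ?c\<^sup>2 *\<^sub>R v = 0"
    proof (rule psd_isotropic_imp_kernel[where f = "\<lambda>x. (M *v x) v* M - ?c\<^sup>2 *\<^sub>R x"])
      show "linear (\<lambda>x. (M *v x) v* M - ?c\<^sup>2 *\<^sub>R x)"
        by (intro linear_compose_sub lin linear_scaleR)
      show "x \<bullet> ((M *v y) v* M - ?c\<^sup>2 *\<^sub>R y) = ((M *v x) v* M - ?c\<^sup>2 *\<^sub>R x) \<bullet> y" for x y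
        by (simp add: inner_simps sym)
      show "0 \<le> x \<bullet> ((M *v x) v* M - ?c\<^sup>2 *\<^sub>R x)" for x
        using power_mono[OF lo[rule_format, of x], of 2]
        by (simp add: inner_simps quad power_mult_distrib power2_norm_eq_inner)
      show "v \<bullet> ((M *v v) v* M - ?c\<^sup>2 *\<^sub>R v) = 0"
        using \<open>norm v = 1\<close> by (simp add: inner_simps quad flip: power2_norm_eq_inner)
    qed
    then show ?thesis by simp
  qed
qed

text \<open>Supplies the left singular vector for the singular value zero. If
  \<open>w \<mapsto> w v* M\<close> were injective, the dimensions would make it surjective; then
  \<open>v = w v* M\<close> for some \<open>w\<close>, and
  \<open>v \<bullet> v = w \<bullet> (M *v v) = 0\<close>.\<close>

lemma tall_matrix_left_kernel:
  fixes M :: "real^'q^'p"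
  assumes le: "CARD('q) \<le> CARD('p)" and v: "v \<noteq> 0" "M *v v = 0"
  obtains w where "norm w = 1" "w v* M = 0"
proof -
  have lin: "linear (\<lambda>w. w v* M)" by (simp flip: transpose_matrix_vector)
  have "\<not> inj (\<lambda>w. w v* M)"
  proof
    assume inj: "inj (\<lambda>w. w v* M)"
    have "dim (range (\<lambda>w. w v* M)) = CARD('p)"
      using dim_image_eq[OF lin, of UNIV] inj by simp
    with le have "dim (range (\<lambda>w. w v* M)) = CARD('q)"
      using dim_subset_UNIV[of "range (\<lambda>w. w v* M)"] by simp
    then have "span (range (\<lambda>w. w v* M)) = UNIV"
      by (intro dim_eq_full[THEN iffD1]) simp
    then have "surj (\<lambda>w. w v* M)"
      by (metis lin linear_span_image span_UNIV)
    then obtain w where "v = w v* M" by (metis surjD)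
    then have "v \<bullet> v = 0" using v(2) by (metis dot_lmul_matrix inner_zero_right)
    with v(1) show False by simp
  qed
  then obtain w where w: "w v* M = 0" "w \<noteq> 0"
    using lin by (auto simp: linear_injective_0)
  have "(w /\<^sub>R norm w) v* M = 0"
    using w linear_scale[OF lin] by simp
  with that[of "w /\<^sub>R norm w"] w show thesis by simp
qed

text \<open>The left singular vector is the normalised \<open>M *v v\<close>; when
  \<open>M *v v\<close> vanishes, a unit vector of the left kernel takes its place.\<close>

lemma singular_valueI:
  fixes M :: "real^'q^'p"
  assumes le: "CARD('q) \<le> CARD('p)" and v: "norm v = 1"
    and ev: "(M *v v) v* M = (norm (M *v v))\<^sup>2 *\<^sub>R v"
  shows "norm (M *v v) \<in> singular_values M"
proof (cases "M *v v = 0")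
  case True
  have "v \<noteq> 0" using v by auto
  from tall_matrix_left_kernel[OF le this True] obtain w where "norm w = 1" "w v* M = 0" .
  with v True show ?thesis unfolding singular_values_def by fastforce
next
  case False
  let ?c = "norm (M *v v)" and ?w = "(M *v v) /\<^sub>R norm (M *v v)"
  have "?w v* M = ?c *\<^sub>R v"
    using False ev matrix_vector_mult_scaleR[of "transpose M" "1 / ?c" "M *v v"]
    by (simp add: power2_eq_square inverse_eq_divide)
  moreover have "norm ?w = 1" "M *v v = ?c *\<^sub>R ?w" using False by simp_all
  ultimately show ?thesis using v unfolding singular_values_def by fastforce
qed

lemma singular_value_vector:
  fixes M :: "real^'q^'p"
  assumes "\<sigma> \<in> singular_values M"
  obtains v where "norm v = 1" "norm (M *v v) = \<sigma>" "(M *v v) v* M = \<sigma>\<^sup>2 *\<^sub>R v"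
proof -
  from assms obtain v w where *: "\<sigma> \<ge> 0" "norm v = 1" "norm w = 1" "M *v v = \<sigma> *\<^sub>R w"
      "w v* M = \<sigma> *\<^sub>R v"
    unfolding singular_values_def by auto
  have "(M *v v) v* M = \<sigma>\<^sup>2 *\<^sub>R v"
    using * matrix_vector_mult_scaleR[of "transpose M" \<sigma> w] by (simp add: power2_eq_square)
  with * show thesis by (intro that[of v]) auto
qed

text \<open>Unit eigenvectors of the Gram matrix for different eigenvalues are orthogonal, and there
  are only finitely many pairwise orthogonal vectors.\<close>

lemma finite_singular_values: "finite (singular_values (M :: real^'q^'p))"
proof -
  have "\<forall>\<sigma>\<in>singular_values M. \<exists>v. norm v = 1 \<and> norm (M *v v) = \<sigma> \<and> (M *v v) v* M = \<sigma>\<^sup>2 *\<^sub>R v"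
    by (meson singular_value_vector)
  then obtain g where g: "\<And>\<sigma>. \<sigma> \<in> singular_values M \<Longrightarrow>
      norm (g \<sigma>) = 1 \<and> norm (M *v g \<sigma>) = \<sigma> \<and> (M *v g \<sigma>) v* M = \<sigma>\<^sup>2 *\<^sub>R g \<sigma>"
    by metis
  have "pairwise orthogonal (g ` singular_values M)"
  proof (rule pairwise_imageI)
    fix \<sigma> \<tau> assume st: "\<sigma> \<in> singular_values M" "\<tau> \<in> singular_values M" "\<sigma> \<noteq> \<tau>"
    have "\<sigma>\<^sup>2 * (g \<sigma> \<bullet> g \<tau>) = (M *v g \<sigma>) \<bullet> (M *v g \<tau>)"
      using g[OF st(1)] by (metis dot_lmul_matrix inner_scaleR_left)
    also have "\<dots> = ((M *v g \<tau>) v* M) \<bullet> g \<sigma>"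
      by (metis dot_lmul_matrix inner_commute)
    also have "\<dots> = \<tau>\<^sup>2 * (g \<sigma> \<bullet> g \<tau>)"
      using g[OF st(2)] by (simp add: inner_commute)
    finally have "(\<sigma>\<^sup>2 - \<tau>\<^sup>2) * (g \<sigma> \<bullet> g \<tau>) = 0" by (simp add: algebra_simps)
    moreover have "\<sigma>\<^sup>2 \<noteq> \<tau>\<^sup>2"
      using st g[OF st(1)] g[OF st(2)] by (metis norm_ge_zero power2_eq_imp_eq)
    ultimately show "orthogonal (g \<sigma>) (g \<tau>)" by (simp add: orthogonal_def)
  qed
  then have "finite (g ` singular_values M)" by (rule pairwise_orthogonal_imp_finite)
  moreover have "inj_on g (singular_values M)" by (rule inj_onI) (metis g)
  ultimately show ?thesis by (rule finite_imageD)
qed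

text \<open>Compactness of the sphere gives the extremal vectors, and homogeneity extends the bounds
  to every \<open>x\<close>.\<close>

lemma unit_sphere_extrema:
  fixes M :: "real^'q^'p"
  obtains v w where "norm v = 1" "\<And>x. norm (M *v x) \<le> norm (M *v v) * norm x"
    "norm w = 1" "\<And>x. norm (M *v w) * norm x \<le> norm (M *v x)"
proof -
  let ?S = "sphere (0 :: real^'q) 1"
  have ne: "?S \<noteq> {}" by simp
  have cont: "continuous_on ?S (\<lambda>x. norm (M *v x))"
    by (intro continuous_on_norm linear_continuous_on) simp
  obtain v where v: "v \<in> ?S" "\<forall>x\<in>?S. norm (M *v x) \<le> norm (M *v v)"
    using continuous_attains_sup[OF compact_sphere ne cont] by blast
  obtain w where w: "w \<in> ?S" "\<forall>x\<in>?S. norm (M *v w) \<le> norm (M *v x)"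
    using continuous_attains_inf[OF compact_sphere ne cont] by blast
  have unit: "x /\<^sub>R norm x \<in> ?S" "norm (M *v (x /\<^sub>R norm x)) = norm (M *v x) / norm x"
    if "x \<noteq> 0" for x
    using that by (simp_all add: matrix_vector_mult_scaleR divide_inverse mult.commute)
  show thesis
  proof (rule that)
    show "norm v = 1" "norm w = 1" using v w by simp_all
    show "norm (M *v x) \<le> norm (M *v v) * norm x" for x
    proof (cases "x = 0")
      case False
      then have "norm (M *v x) / norm x \<le> norm (M *v v)" using v(2) unit[of x] by metis
      then show ?thesis using False by (simp add: divide_le_eq)
    qed simp
    show "norm (M *v w) * norm x \<le> norm (M *v x)" for x
    proof (cases "x = 0")
      case False
      then have "norm (M *v w) \<le> norm (M *v x) / norm x" using w(2) unit[of x] by metis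
      then show ?thesis using False by (simp add: le_divide_eq)
    qed simp
  qed
qed

text \<open>The maximiser of \<open>norm (M *v x)\<close> on the unit sphere is a Gram eigenvector,
  so its value is a singular value. Every singular value is attained at some unit vector, so none is
  larger. The minimiser serves \<open>sigma_min_bound\<close> in the same way.\<close>

lemma sigma_max_bound:
  fixes M :: "real^'q^'p"
  assumes "CARD('q) \<le> CARD('p)"
  shows "norm (M *v x) \<le> sigma_max M * norm x"
    and "\<exists>v. norm v = 1 \<and> norm (M *v v) = sigma_max M"
proof -
  obtain v where v: "norm v = 1" "\<And>x. norm (M *v x) \<le> norm (M *v v) * norm x"
    using unit_sphere_extrema by metis
  have mem: "norm (M *v v) \<in> singular_values M"
    using v by (intro singular_valueI assms gram_eigenvector) auto
  have eq: "sigma_max M = norm (M *v v)"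
    unfolding sigma_max_def
  proof (rule Max_eqI[OF finite_singular_values _ mem])
    fix \<sigma> assume "\<sigma> \<in> singular_values M"
    then obtain z where "norm z = 1" "norm (M *v z) = \<sigma>" by (rule singular_value_vector)
    then show "\<sigma> \<le> norm (M *v v)" using v(2)[of z] by simp
  qed
  show "norm (M *v x) \<le> sigma_max M * norm x" using v(2) eq by simp
  show "\<exists>v. norm v = 1 \<and> norm (M *v v) = sigma_max M" using v(1) eq by auto
qed

lemma sigma_min_bound:
  fixes M :: "real^'q^'p"
  assumes "CARD('q) \<le> CARD('p)"
  shows "sigma_min M * norm x \<le> norm (M *v x)"
    and "\<exists>v. norm v = 1 \<and> norm (M *v v) = sigma_min M"
proof -
  obtain v where v: "norm v = 1" "\<And>x. norm (M *v v) * norm x \<le> norm (M *v x)"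
    using unit_sphere_extrema by metis
  have mem: "norm (M *v v) \<in> singular_values M"
    using v by (intro singular_valueI assms gram_eigenvector) auto
  have eq: "sigma_min M = norm (M *v v)"
    unfolding sigma_min_def
  proof (rule Min_eqI[OF finite_singular_values _ mem])
    fix \<sigma> assume "\<sigma> \<in> singular_values M"
    then obtain z where "norm z = 1" "norm (M *v z) = \<sigma>" by (rule singular_value_vector)
    then show "norm (M *v v) \<le> \<sigma>" using v(2)[of z] by simp
  qed
  show "sigma_min M * norm x \<le> norm (M *v x)" using v(2) eq by simp
  show "\<exists>v. norm v = 1 \<and> norm (M *v v) = sigma_min M" using v(1) eq by auto
qed

lemma sigma_le:
  fixes M :: "real^'q^'p"
  assumes "CARD('q) \<le> CARD('p)"
  shows "0 \<le> sigma_min M" "sigma_min M \<le> sigma_max M"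
proof -
  obtain v where v: "norm v = 1" "norm (M *v v) = sigma_min M"
    using sigma_min_bound(2)[OF assms] by blast
  from v(2) show "0 \<le> sigma_min M" by (metis norm_ge_zero)
  from v show "sigma_min M \<le> sigma_max M" using sigma_max_bound(1)[OF assms, of M v] by simp
qed

lemma spectral_norm_eq_sigma_max:
  fixes M :: "real^'q^'p"
  assumes "CARD('q) \<le> CARD('p)"
  shows "spectral_norm M = sigma_max M"
proof (rule antisym)
  show "spectral_norm M \<le> sigma_max M"
    by (rule spectral_norm_le) (rule sigma_max_bound(1)[OF assms])
  show "sigma_max M \<le> spectral_norm M"
    using sigma_max_bound(2)[OF assms, of M] norm_matrix_vector_le_spectral[of M]
    by (metis mult.right_neutral)
qed

text \<open>Both extreme singular values are attained at unit vectors and so inherit the bounds;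
  \<open>0 < a\<close> excludes the infinite value of \<open>cond2\<close>.\<close>

lemma cond2_le:
  fixes M :: "real^'q^'p"
  assumes le: "CARD('q) \<le> CARD('p)" and a: "0 < a"
    and lo: "\<And>x. a * norm x \<le> norm (M *v x)" and up: "\<And>x. norm (M *v x) \<le> b * norm x"
  shows "cond2 M \<le> ereal (b / a)"
proof -
  obtain v where "norm v = 1" "norm (M *v v) = sigma_min M"
    using sigma_min_bound(2)[OF le] by blast
  then have min: "a \<le> sigma_min M" using lo[of v] by simp
  obtain v where "norm v = 1" "norm (M *v v) = sigma_max M"
    using sigma_max_bound(2)[OF le] by blast
  then have max: "sigma_max M \<le> b" using up[of v] by simp
  have "sigma_max M / sigma_min M \<le> b / a"
    using a min max sigma_le[OF le, of M] by (intro frac_le) auto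
  then show ?thesis using a min by (simp add: cond2_def)
qed

lemma cond2_less_ereal:
  fixes M :: "real^'q^'p"
  assumes le: "CARD('q) \<le> CARD('p)" and "cond2 M < ereal b"
  shows "0 < sigma_min M" "sigma_max M / sigma_min M < b" "cond2 M = ereal (sigma_max M / sigma_min M)"
  using assms sigma_le[OF le, of M] by (auto simp: cond2_def split: if_splits)

section \<open>Pseudoinverses and isometries\<close>

text \<open>Justifies the \<open>THE\<close> in \<open>pseudoinverse\<close>. Inserting
  \<open>M = M ** Y ** M\<close> and transposing the symmetric products identifies
  \<open>M ** X\<close> with \<open>M ** Y\<close> and \<open>X ** M\<close> with
  \<open>Y ** M\<close>.\<close>

lemma is_pseudoinverse_unique:
  fixes M :: "real^'q^'p"
  assumes X: "is_pseudoinverse M X" and Y: "is_pseudoinverse M Y"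
  shows "X = Y"
proof -
  note x = X[unfolded is_pseudoinverse_def] and y = Y[unfolded is_pseudoinverse_def]
  have "M ** X = (M ** Y ** M) ** X" using y by simp
  also have "\<dots> = transpose (M ** Y) ** transpose (M ** X)"
    using x y by (simp add: matrix_mul_assoc)
  also have "\<dots> = transpose ((M ** X ** M) ** Y)" by (simp add: matrix_transpose_mul matrix_mul_assoc)
  also have "\<dots> = M ** Y" using x y by simp
  finally have MX: "M ** X = M ** Y" .
  have "X ** M = X ** (M ** Y ** M)" using y by simp
  also have "\<dots> = (X ** M) ** (Y ** M)" by (simp only: matrix_mul_assoc)
  also have "\<dots> = transpose (X ** M) ** transpose (Y ** M)" using x y by simp
  also have "\<dots> = transpose (Y ** M ** (X ** M))" by (simp only: matrix_transpose_mul)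
  also have "\<dots> = transpose (Y ** (M ** X ** M))" by (simp only: matrix_mul_assoc)
  also have "\<dots> = Y ** M" using x y by simp
  finally have XM: "X ** M = Y ** M" .
  have "X = X ** (M ** X)" using x by (simp add: matrix_mul_assoc)
  also have "\<dots> = Y ** M ** Y" by (simp add: MX XM matrix_mul_assoc)
  also have "\<dots> = Y" using y by simp
  finally show ?thesis .
qed

text \<open>A trivial kernel makes the Gram matrix invertible. Its inverse \<open>H\<close> is
  symmetric, so \<open>H ** transpose M\<close> satisfies the four Penrose equations.\<close>

lemma pseudoinverse_left_inverse:
  fixes M :: "real^'q^'p"
  assumes inj: "\<And>x. M *v x = 0 \<Longrightarrow> x = 0"
  shows "pseudoinverse M ** M = mat 1"
proof -
  let ?G = "transpose M ** M"
  have "x = 0" if "?G *v x = 0" for x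
  proof -
    have "(M *v x) v* M = 0" using that by (simp flip: matrix_vector_mul_assoc)
    then have "(M *v x) \<bullet> (M *v x) = 0" by (metis dot_lmul_matrix inner_zero_left)
    then show ?thesis using inj by simp
  qed
  then obtain H where H: "H ** ?G = mat 1" by (metis matrix_left_invertible_ker)
  then have H': "?G ** H = mat 1" by (simp add: matrix_left_right_inverse)
  have Gt: "transpose ?G = ?G" by (simp add: matrix_transpose_mul)
  have "transpose H ** ?G = mat 1" using H' Gt by (metis matrix_transpose_mul transpose_mat)
  then have Ht: "transpose H = H"
    using H' by (metis matrix_mul_assoc matrix_mul_lid matrix_mul_rid)
  let ?X = "H ** transpose M"
  have XM: "?X ** M = mat 1" using H by (simp add: matrix_mul_assoc)
  have X: "is_pseudoinverse M ?X"
    unfolding is_pseudoinverse_def using XM Ht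
    by (simp add: matrix_transpose_mul transpose_mat flip: matrix_mul_assoc)
  then have "pseudoinverse M = ?X"
    unfolding pseudoinverse_def by (rule the_equality) (rule is_pseudoinverse_unique[OF _ X])
  then show ?thesis using XM by simp
qed

lemma norm_orthonormal_columns:
  fixes Q :: "real^'q^'p"
  assumes "orthonormal_columns Q"
  shows "norm (Q *v x) = norm x"
proof -
  have "(Q *v x) v* Q = x"
    using assms matrix_vector_mul_assoc[of "transpose Q" Q x]
    by (simp add: orthonormal_columns_def)
  then have "(Q *v x) \<bullet> (Q *v x) = x \<bullet> x"
    by (metis dot_lmul_matrix)
  then show ?thesis by (simp add: norm_eq_sqrt_inner)
qed

text \<open>The pseudoinverse returns a unit vector \<open>v\<close> from \<open>M *v v\<close>;
  choosing \<open>v\<close> with \<open>norm (M *v v) = sigma_min M\<close> gives the bound.\<close>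

lemma pseudoinverse_spectral_norm_bound:
  fixes M :: "real^'q^'p"
  assumes le: "CARD('q) \<le> CARD('p)" and pos: "0 < sigma_min M"
  shows "1 \<le> spectral_norm (pseudoinverse M) * sigma_min M"
proof -
  have "x = 0" if "M *v x = 0" for x
    using sigma_min_bound(1)[OF le, of M x] that pos by (simp add: mult_le_0_iff)
  then have left: "pseudoinverse M ** M = mat 1" by (rule pseudoinverse_left_inverse)
  obtain v where v: "norm v = 1" "norm (M *v v) = sigma_min M"
    using sigma_min_bound(2)[OF le] by blast
  have "pseudoinverse M *v (M *v v) = v" by (simp add: matrix_vector_mul_assoc left)
  then show ?thesis using norm_matrix_vector_le_spectral[of "pseudoinverse M" "M *v v"] v by simp
qed

section \<open>Error bounds for the floating-point operations\<close>

text \<open>Every row has its own \<Delta>, so rows are treated separately. For the computed row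
  \<open>y\<close> and the exact row \<open>z\<close>, \<open>z - y = y v* \<Delta> v* H\<close>,
  and \<Delta> is bounded by \<open>gam\<close> times \<open>Rhat\<close> in the Frobenius
  norm.\<close>

lemma forward_substitution_error:
  fixes A Yhat :: "real^'n^'m" and Rhat H :: "real^'n^'n"
  assumes comp: "computed_forward_substitution u A Rhat Yhat"
    and inv: "Rhat ** H = mat 1"
    and g: "0 \<le> gam u CARD('n)"
    and H: "\<And>x. norm (H *v x) \<le> h * norm x" and h: "0 \<le> h"
    and d: "gam u CARD('n) * norm Rhat * h \<le> \<delta>" and d1: "\<delta> < 1"
  shows "norm (Yhat - A ** H) \<le> \<delta> / (1 - \<delta>) * norm (A ** H)"
proof -
  have d0: "0 \<le> \<delta>" using d g h by (meson mult_nonneg_nonneg norm_ge_zero order_trans)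
  have row: "norm ((Yhat - A ** H) $ i) \<le> \<delta> / (1 - \<delta>) * norm ((A ** H) $ i)" for i
  proof -
    let ?y = "Yhat $ i" and ?z = "(A ** H) $ i"
    obtain \<Delta> where eq: "row i Yhat v* (Rhat + \<Delta>) = row i A"
      and bd: "\<And>j k. \<bar>\<Delta> $ j $ k\<bar> \<le> gam u CARD('n) * \<bar>Rhat $ j $ k\<bar>"
      using comp unfolding computed_forward_substitution_def by blast
    have rows: "row i Yhat = ?y" "row i A = A $ i" by (simp_all add: row_def)
    have z: "?z = (A $ i) v* H"
      by (simp add: vec_eq_iff matrix_matrix_mult_def vector_matrix_mult_def mult.commute)
    have "norm \<Delta> \<le> norm (gam u CARD('n) *\<^sub>R Rhat)"
      unfolding norm_vec_def using bd g by (intro L2_set_mono) (simp_all add: abs_mult)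
    then have \<Delta>: "norm \<Delta> \<le> gam u CARD('n) * norm Rhat" using g by simp
    have "?z = ?y v* (Rhat + \<Delta>) v* H" using eq z rows by simp
    also have "\<dots> = ?y v* Rhat v* H + ?y v* \<Delta> v* H"
      by (simp only: vector_matrix_left_distrib vector_matrix_mult_add_rdistrib)
    also have "?y v* Rhat v* H = ?y" by (simp add: vector_matrix_mul_assoc inv)
    finally have "?z - ?y = ?y v* \<Delta> v* H" by simp
    then have "norm (?y - ?z) = norm (?y v* \<Delta> v* H)" by (metis norm_minus_commute)
    also have "\<dots> \<le> h * norm (?y v* \<Delta>)" by (rule norm_vector_matrix_le) (rule H)
    also have "\<dots> \<le> h * (norm \<Delta> * norm ?y)"
      by (intro mult_left_mono h norm_vector_matrix_le norm_matrix_vector_le_frobenius)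
    also have "\<dots> \<le> h * (gam u CARD('n) * norm Rhat * norm ?y)"
      by (intro mult_left_mono mult_right_mono h \<Delta>) simp
    also have "\<dots> = gam u CARD('n) * norm Rhat * h * norm ?y" by simp
    also have "\<dots> \<le> \<delta> * norm ?y" by (intro mult_right_mono d) simp
    \<comment> \<open>The error reappears on the right with factor \<delta> < 1 and can be
      absorbed.\<close>
    also have "\<dots> \<le> \<delta> * (norm ?z + norm (?y - ?z))"
      by (intro mult_left_mono d0 norm_triangle_sub)
    finally have "(1 - \<delta>) * norm (?y - ?z) \<le> \<delta> * norm ?z" by (simp add: algebra_simps)
    then show ?thesis using d1 by (simp add: field_simps)
  qed
  have "norm (Yhat - A ** H) = L2_set (\<lambda>i. norm ((Yhat - A ** H) $ i)) UNIV"
    by (simp add: norm_vec_def)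
  also have "\<dots> \<le> L2_set (\<lambda>i. \<delta> / (1 - \<delta>) * norm ((A ** H) $ i)) UNIV"
    by (intro L2_set_mono row) simp
  also have "\<dots> = \<delta> / (1 - \<delta>) * norm (A ** H)"
    unfolding norm_vec_def[of "A ** H"] using d0 d1 by (intro L2_set_right_distrib[symmetric]) simp
  finally show ?thesis .
qed

text \<open>The isometry \<open>Qt\<close> drops out of the norm, leaving
  \<open>E = E1 + E2\<close>. The product error gives the first summand of \<open>C1\<close>. The QR
  error is relative to \<open>Bhat\<close>, which already contains \<open>E1\<close>; hence the
  factor \<open>1 + \<gamma>\<close> in the second summand.\<close>

lemma computed_QR_of_product_error:
  fixes A :: "real^('n::{finite,linorder})^'m" and S :: "real^'m^'s"
  assumes Bhat: "computed_product u S A Bhat"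
    and Rhat: "computed_QR_factor c u Bhat Rhat"
    and g: "0 \<le> gam u CARD('m)" and gt: "0 \<le> gam_tilde c u (CARD('s) * CARD('n))"
  obtains E where "\<And>x. norm (Rhat *v x) = norm (S *v (A *v x) + E *v x)"
    "\<And>x. norm (E *v x) \<le>
       C1 c u CARD('m) CARD('s) CARD('n) * (spectral_norm S * spectral_norm A) * norm x"
proof -
  define \<gamma> \<gamma>t where "\<gamma> = sqrt (real (CARD('s) * CARD('n))) * gam u CARD('m)"
    and "\<gamma>t = gam_tilde c u (CARD('s) * CARD('n))"
  let ?N = "spectral_norm S * spectral_norm A"
  have N: "0 \<le> ?N" by (simp add: spectral_norm_nonneg)
  have pos: "0 \<le> \<gamma>" "0 \<le> \<gamma>t" using g gt by (simp_all add: \<gamma>_def \<gamma>t_def)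
  from Bhat obtain E1 where E1: "Bhat = S ** A + E1" "spectral_norm E1 \<le> \<gamma> * ?N"
    unfolding computed_product_def \<gamma>_def by (auto simp: mult_ac)
  from Rhat obtain Qt :: "real^('n::{finite,linorder})^'s" and E2 where
    Q: "orthonormal_columns Qt" "Qt ** Rhat = Bhat + E2" and E2: "norm E2 \<le> \<gamma>t * norm Bhat"
    unfolding computed_QR_factor_def \<gamma>t_def by auto
  have e1: "norm (E1 *v x) \<le> \<gamma> * ?N * norm x" for x
    by (rule order_trans[OF norm_matrix_vector_le_spectral]) (intro mult_right_mono E1 norm_ge_zero)
  have B: "norm (Bhat *v x) \<le> (1 + \<gamma>) * ?N * norm x" for x
  proof -
    have "norm (S *v (A *v x)) \<le> spectral_norm S * norm (A *v x)"
      by (rule norm_matrix_vector_le_spectral)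
    also have "\<dots> \<le> spectral_norm S * (spectral_norm A * norm x)"
      by (intro mult_left_mono norm_matrix_vector_le_spectral spectral_norm_nonneg)
    finally have "norm (S *v (A *v x)) \<le> ?N * norm x" by simp
    moreover have "Bhat *v x = S *v (A *v x) + E1 *v x"
      by (simp add: E1 matrix_vector_mult_add_rdistrib matrix_vector_mul_assoc)
    ultimately show ?thesis
      using norm_triangle_ineq[of "S *v (A *v x)" "E1 *v x"] e1[of x] by (simp add: algebra_simps)
  qed
  \<comment> \<open>The QR error bound uses the Frobenius norm of \<open>Bhat\<close>; passing to it
    from the operator bound produces the \<open>sqrt n\<close> in \<open>C1\<close>.\<close>
  have "norm Bhat \<le> sqrt (real CARD('n)) * ((1 + \<gamma>) * ?N)"
    by (rule frobenius_le_sqrt_spectral[OF B]) (use pos N in simp)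
  then have "\<gamma>t * norm Bhat \<le> \<gamma>t * (sqrt (real CARD('n)) * ((1 + \<gamma>) * ?N))"
    by (intro mult_left_mono pos)
  with E2 have e2': "norm E2 \<le> sqrt (real CARD('n)) * \<gamma>t * (1 + \<gamma>) * ?N"
    by (simp add: mult_ac)
  have e2: "norm (E2 *v x) \<le> sqrt (real CARD('n)) * \<gamma>t * (1 + \<gamma>) * ?N * norm x" for x
    by (rule order_trans[OF norm_matrix_vector_le_frobenius]) (intro mult_right_mono e2' norm_ge_zero)
  show thesis
  proof (rule that[of "E1 + E2"])
    fix x
    have "norm (Rhat *v x) = norm ((Qt ** Rhat) *v x)"
      by (simp add: norm_orthonormal_columns[OF Q(1)] flip: matrix_vector_mul_assoc)
    also have "(Qt ** Rhat) *v x = S *v (A *v x) + (E1 + E2) *v x"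
      by (simp add: Q(2) E1 matrix_vector_mult_add_rdistrib matrix_vector_mul_assoc)
    finally show "norm (Rhat *v x) = norm (S *v (A *v x) + (E1 + E2) *v x)" .
    have "norm ((E1 + E2) *v x) \<le> norm (E1 *v x) + norm (E2 *v x)"
      by (simp add: matrix_vector_mult_add_rdistrib norm_triangle_ineq)
    also have "\<dots> \<le> \<gamma> * ?N * norm x + sqrt (real CARD('n)) * \<gamma>t * (1 + \<gamma>) * ?N * norm x"
      by (intro add_mono e1 e2)
    also have "\<dots> = C1 c u CARD('m) CARD('s) CARD('n) * ?N * norm x"
      by (simp add: C1_def \<gamma>_def \<gamma>t_def algebra_simps)
    finally show "norm ((E1 + E2) *v x) \<le> C1 c u CARD('m) CARD('s) CARD('n) * ?N * norm x" .
  qed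
qed

section \<open>Numerical estimates for the constants\<close>

lemma rounding_unit_le:
  fixes k :: real
  assumes "0 \<le> k" "k < 1"
  shows "k \<le> k / (1 - k)"
proof -
  have "k * (1 - k) \<le> k * 1" using assms by (intro mult_left_mono) auto
  then show ?thesis using assms by (simp add: pos_le_divide_eq)
qed

text \<open>Since \<open>s > n\<close> and \<open>c \<ge> 1\<close>, the two summands of
  \<open>C1\<close> are at least \<open>n * m * u\<close> and \<open>sqrt n * n^2 * u\<close>. Their
  sum is \<open>(m / n + sqrt n) * n^2 * u\<close>.\<close>

lemma C1_lower_bound:
  fixes m s n c :: nat and u :: real
  assumes "s > n" "n \<ge> 1" "u > 0" "c \<ge> 1"
    "real m * u < 1" "real c * real s * real n * u < 1"
    and mn: "real m / real n + sqrt (real n) > 200"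
  shows "200 * (real n)\<^sup>2 * u < C1 c u m s n"
proof -
  have g: "real m * u \<le> gam u m" unfolding gam_def using assms by (intro rounding_unit_le) auto
  have g0: "0 \<le> gam u m" by (rule order_trans[OF _ g]) (use assms in simp)
  have "real (s * n) * u \<le> real c * (real (s * n) * u)"
    using assms mult_right_mono[of 1 "real c" "real (s * n) * u"] by simp
  also have "\<dots> \<le> gam_tilde c u (s * n)"
    unfolding gam_tilde_def
    using assms rounding_unit_le[of "real c * real (s * n) * u"] by (simp add: mult.assoc)
  finally have t: "real (s * n) * u \<le> gam_tilde c u (s * n)" .
  have sn: "(real n)\<^sup>2 \<le> real (s * n)"
    using assms by (simp add: power2_eq_square mult_right_mono)
  have rt: "real n \<le> sqrt (real (s * n))" by (rule real_le_rsqrt[OF sn])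
  have t': "(real n)\<^sup>2 * u \<le> gam_tilde c u (s * n)"
    by (rule order_trans[OF _ t]) (intro mult_right_mono sn, use assms in simp)
  have t0: "0 \<le> gam_tilde c u (s * n)" by (rule order_trans[OF _ t']) (use assms in simp)
  have "200 * (real n)\<^sup>2 * u < (real m / real n + sqrt (real n)) * ((real n)\<^sup>2 * u)"
    using assms mult_strict_right_mono[OF mn, of "(real n)\<^sup>2 * u"] by simp
  also have "\<dots> = real n * (real m * u) + sqrt (real n) * ((real n)\<^sup>2 * u) * 1"
    using assms by (simp add: field_simps power2_eq_square)
  also have "\<dots> \<le> C1 c u m s n"
    unfolding C1_def
    by (intro add_mono mult_mono rt g t') (use assms g0 t0 in auto)
  finally show ?thesis .
qed

text \<open>With \<open>t = \<kappa> + 1/3\<close> the target is \<open>4 * t - 1/3\<close>. The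
  quotient is about \<open>3/2 * t\<close> divided by a number that is at least \<open>3/4\<close>,
  hence at most about \<open>2 * t\<close>.\<close>

lemma ratio_bound:
  fixes \<kappa> :: real
  assumes "1 \<le> \<kappa>" "\<kappa> < 49" "\<epsilon> = 337 / 100000"
  shows "0 < 1 / (\<kappa> + 1/3) - \<epsilon> * (3/2)"
    and "((1 + \<epsilon>) * (3/2)) / (1 / (\<kappa> + 1/3) - \<epsilon> * (3/2)) \<le> 4 * \<kappa> + 1"
proof -
  define t where "t = \<kappa> + 1/3"
  have t: "1 < t" "t < 148/3" "4 * \<kappa> + 1 = 4 * t - 1/3" using assms by (auto simp: t_def)
  \<comment> \<open>Here \<open>\<kappa> < 49\<close> enters:
    \<open>3/2 * \<epsilon> * 148/3 = 0.24938\<close>, just below \<open>1/4\<close>.\<close>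
  have et: "3/2 * \<epsilon> * t \<le> 1/4" using t(2) unfolding assms(3) by simp
  then have pos: "0 < 1 - 3/2 * \<epsilon> * t" by linarith
  have eq: "1 / t - \<epsilon> * (3/2) = (1 - 3/2 * \<epsilon> * t) / t" using t by (simp add: field_simps)
  show "0 < 1 / (\<kappa> + 1/3) - \<epsilon> * (3/2)"
    using pos t eq unfolding t_def[symmetric] by simp
  have "(1 + \<epsilon>) * (3/2) * t \<le> (3 * t) * (3/4)" using t(1) unfolding assms(3) by simp
  also have "\<dots> \<le> (4 * t - 1/3) * (1 - 3/2 * \<epsilon> * t)"
    by (intro mult_mono) (use t(1) et in linarith)+
  finally have "(1 + \<epsilon>) * (3/2) * t / (1 - 3/2 * \<epsilon> * t) \<le> 4 * t - 1/3"
    using pos by (subst pos_divide_le_eq) auto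
  then show "((1 + \<epsilon>) * (3/2)) / (1 / (\<kappa> + 1/3) - \<epsilon> * (3/2)) \<le> 4 * \<kappa> + 1"
    unfolding t_def[symmetric] eq t(3) by simp
qed

section \<open>Condition number of the computed preconditioned matrix\<close>

theorem theorem3p4:
  fixes A QA Yhat :: "real^('n::{finite,linorder})^'m"
    and S :: "real^'m^'s"
    and Q Bhat :: "real^('n::{finite,linorder})^'s"
    and RA R Rhat :: "real^('n::{finite,linorder})^('n::{finite,linorder})"
    and m s n c :: nat
    and u :: real
  assumes dims: "m = CARD('m)" "s = CARD('s)" "n = CARD('n)"
    and sizes: "m > s" "s > n" "n \<ge> 1"
    and A: "lin_indep_columns A"
    and S: "lin_indep_rows S"
    and SA: "rank (S ** A) = n"
    and qrA: "economized_QR A QA RA"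
    and qrSA: "economized_QR (S ** A) Q R"
    and rounding: "u > 0" "c \<ge> 1" "real m * u < 1" "real c * real s * real n * u < 1"
    and cond_SQA: "cond2 (S ** QA) < 49"
    and nu: "(real n)\<^sup>2 * u < 1 / 201"
    and mn: "real m / real n + sqrt (real n) > 200"
    and cond_A: "cond2 A < ereal (1 / (3 * C1 c u m s n * k_sketch S QA))"
    and Bhat: "computed_product u S A Bhat"
    and Rhat: "computed_QR_factor c u Bhat Rhat"
    and Yhat: "computed_forward_substitution u A Rhat Yhat"
  shows "cond2 Yhat \<le> 4 * cond2 (S ** QA) + 1"
proof -
  let ?M = "S ** QA"
  define \<sigma> \<Sigma> \<alpha> \<beta> where "\<sigma> = sigma_min ?M" and "\<Sigma> = sigma_max ?M"
    and "\<alpha> = sigma_min A" and "\<beta> = sigma_max A"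
  define \<kappa> where "\<kappa> = \<Sigma> / \<sigma>"
  define NS X where "NS = spectral_norm S" and "X = spectral_norm (pseudoinverse ?M)"
  define C where "C = C1 c u m s n"
  define t \<epsilon> :: real where "t = \<kappa> + 1/3" and "\<epsilon> = 337 / 100000"
  have le_s: "CARD('n) \<le> CARD('s)" and le_m: "CARD('n) \<le> CARD('m)" using dims sizes by auto
  have n0: "0 < real n" using sizes by simp

  have "cond2 ?M < ereal 49" using cond_SQA by simp
  note M = cond2_less_ereal[OF le_s this, folded \<sigma>_def \<Sigma>_def, folded \<kappa>_def]
  have \<sigma>: "0 < \<sigma>" and \<kappa>49: "\<kappa> < 49" using M by auto
  have \<kappa>1: "1 \<le> \<kappa>" using sigma_le(2)[OF le_s, of ?M] \<sigma> unfolding \<kappa>_def \<sigma>_def \<Sigma>_def by simp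
  have \<Sigma>: "\<Sigma> = \<kappa> * \<sigma>" using \<sigma> by (simp add: \<kappa>_def)
  note A' = cond2_less_ereal[OF le_m cond_A, folded \<alpha>_def \<beta>_def]
  have \<alpha>: "0 < \<alpha>" using A' by simp
  have \<beta>: "0 \<le> \<beta>" using sigma_le[OF le_m, of A] unfolding \<beta>_def by linarith
  have Alo: "\<alpha> * norm x \<le> norm (A *v x)" and Aup: "norm (A *v x) \<le> \<beta> * norm x" for x
    unfolding \<alpha>_def \<beta>_def by (rule sigma_min_bound[OF le_m] sigma_max_bound[OF le_m])+
  have QA: "orthonormal_columns QA" and RA: "A = QA ** RA"
    using qrA by (auto simp: economized_QR_def)

  have NS0: "0 \<le> NS" and X0: "0 \<le> X" by (simp_all add: NS_def X_def spectral_norm_nonneg)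
  have X\<sigma>: "1 \<le> X * \<sigma>"
    unfolding X_def \<sigma>_def
    by (rule pseudoinverse_spectral_norm_bound[OF le_s]) (use \<sigma> in \<open>simp add: \<sigma>_def\<close>)
  \<comment> \<open>Towards \<open>\<kappa> \<le> NS * X\<close>, where \<open>NS * X\<close> is
    \<open>k_sketch S QA\<close>: \<open>QA\<close> preserves norms, and
    \<open>1 / \<sigma> \<le> X\<close>.\<close>
  have "\<Sigma> \<le> NS"
    unfolding \<Sigma>_def spectral_norm_eq_sigma_max[OF le_s, symmetric]
  proof (rule spectral_norm_le)
    show "norm (?M *v x) \<le> NS * norm x" for x
      using norm_matrix_vector_le_spectral[of S "QA *v x"] norm_orthonormal_columns[OF QA, of x]
      by (simp add: NS_def matrix_vector_mul_assoc)
  qed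
  then have "\<kappa> \<le> NS * (1 / \<sigma>)" using \<sigma> by (simp add: \<kappa>_def divide_right_mono)
  also have "\<dots> \<le> NS * X" using X\<sigma> \<sigma> NS0 by (intro mult_left_mono) (simp_all add: pos_divide_le_eq)
  finally have \<kappa>K: "\<kappa> \<le> NS * X" .
  then have K0: "0 < NS * X" using \<kappa>1 by linarith

  have C: "200 * (real n)\<^sup>2 * u < C"
    unfolding C_def using sizes rounding mn by (intro C1_lower_bound) auto
  then have C0: "0 < C" using rounding by (smt (verit) mult_nonneg_nonneg zero_le_power2)
  have "\<beta> / \<alpha> < 1 / (3 * C * (NS * X))"
    using A'(2) by (simp add: k_sketch_def NS_def X_def C_def)
  then have CK: "(NS * X) * (\<beta> / \<alpha>) < 1 / (3 * C)"
    using K0 C0 by (simp add: field_simps)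
  \<comment> \<open>The factor \<open>X * \<sigma> \<ge> 1\<close> is inserted to form
    \<open>(NS * X) * (\<beta> / \<alpha>)\<close>, which the bound on \<open>cond2 A\<close> keeps
    below \<open>1 / (3 * C)\<close>.\<close>
  have "C * (NS * \<beta>) \<le> C * (NS * \<beta>) * (X * \<sigma>)"
    using X\<sigma> C0 NS0 \<beta> mult_left_mono[of 1 "X * \<sigma>" "C * (NS * \<beta>)"] by simp
  also have "\<dots> = C * ((NS * X) * (\<beta> / \<alpha>)) * (\<sigma> * \<alpha>)" using \<alpha> by simp
  also have "\<dots> \<le> C * (1 / (3 * C)) * (\<sigma> * \<alpha>)"
    using CK C0 \<sigma> \<alpha> by (intro mult_right_mono mult_left_mono) auto
  also have "\<dots> = \<sigma> / 3 * \<alpha>" using C0 by simp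
  finally have pert: "C * (NS * \<beta>) \<le> \<sigma> / 3 * \<alpha>" .

  have g: "0 \<le> gam u CARD('m)" using rounding dims by (simp add: gam_def)
  have gt: "0 \<le> gam_tilde c u (CARD('s) * CARD('n))"
    using rounding dims by (simp add: gam_tilde_def mult.assoc)
  obtain E where RE: "\<And>x. norm (Rhat *v x) = norm (S *v (A *v x) + E *v x)"
    and E: "\<And>x. norm (E *v x) \<le> C * (NS * \<beta>) * norm x"
    using computed_QR_of_product_error[OF Bhat Rhat g gt] dims
    unfolding C_def NS_def \<beta>_def spectral_norm_eq_sigma_max[OF le_m, symmetric] by metis
  have EA: "norm (E *v x) \<le> \<sigma> / 3 * norm (A *v x)" for x
  proof -
    have "norm (E *v x) \<le> \<sigma> / 3 * \<alpha> * norm x"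
      by (rule order_trans[OF E]) (intro mult_right_mono pert norm_ge_zero)
    also have "\<dots> \<le> \<sigma> / 3 * norm (A *v x)"
      using mult_left_mono[OF Alo[of x], of "\<sigma> / 3"] \<sigma> by simp
    finally show ?thesis .
  qed
  have SA: "\<sigma> * norm (A *v x) \<le> norm (S *v (A *v x))"
    "norm (S *v (A *v x)) \<le> \<kappa> * \<sigma> * norm (A *v x)" for x
  proof -
    have *: "norm (A *v x) = norm (RA *v x)" "S *v (A *v x) = ?M *v (RA *v x)"
      using norm_orthonormal_columns[OF QA, of "RA *v x"]
      by (simp_all add: RA matrix_vector_mul_assoc matrix_mul_assoc)
    show "\<sigma> * norm (A *v x) \<le> norm (S *v (A *v x))"
      unfolding * \<sigma>_def by (rule sigma_min_bound(1)[OF le_s])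
    show "norm (S *v (A *v x)) \<le> \<kappa> * \<sigma> * norm (A *v x)"
      unfolding * \<Sigma>[symmetric] \<Sigma>_def by (rule sigma_max_bound(1)[OF le_s])
  qed
  have Rlo: "2/3 * \<sigma> * norm (A *v x) \<le> norm (Rhat *v x)" for x
    using SA(1)[of x] EA[of x] norm_diff_ineq[of "S *v (A *v x)" "E *v x"] RE[of x] by simp
  have Rup: "norm (Rhat *v x) \<le> \<sigma> * t * norm (A *v x)" for x
    using SA(2)[of x] EA[of x] norm_triangle_ineq[of "S *v (A *v x)" "E *v x"] RE[of x]
    by (simp add: t_def algebra_simps)

  have Rlo': "2/3 * \<sigma> * \<alpha> * norm x \<le> norm (Rhat *v x)" for x
    using order_trans[OF mult_left_mono[OF Alo] Rlo, of x] \<sigma> by (simp add: mult.assoc)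
  have "x = 0" if "Rhat *v x = 0" for x
    using Rlo'[of x] that \<sigma> \<alpha> by (simp add: mult_le_0_iff)
  then obtain H where "H ** Rhat = mat 1" by (metis matrix_left_invertible_ker)
  then have inv: "Rhat ** H = mat 1" by (simp add: matrix_left_right_inverse)
  have RH: "Rhat *v (H *v y) = y" for y by (simp add: matrix_vector_mul_assoc inv)
  have H: "norm (H *v y) \<le> 3 / (2 * \<sigma> * \<alpha>) * norm y" for y
    using Rlo'[of "H *v y"] \<sigma> \<alpha> unfolding RH by (simp add: field_simps)
  let ?Z = "A ** H"
  \<comment> \<open>Comparisons of \<open>Rhat *v x\<close> with \<open>A *v x\<close> turn into
    bounds on \<open>?Z\<close> at \<open>x = H *v y\<close>.\<close>
  have Zup: "norm (?Z *v y) \<le> 3/2 / \<sigma> * norm y" for y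
    using Rlo[of "H *v y"] \<sigma> unfolding RH by (simp add: field_simps matrix_vector_mul_assoc)
  have t0: "0 < t" using \<kappa>1 by (simp add: t_def)
  have Zlo: "1 / t / \<sigma> * norm y \<le> norm (?Z *v y)" for y
    using Rup[of "H *v y"] \<sigma> t0 unfolding RH by (simp add: field_simps matrix_vector_mul_assoc)

  \<comment> \<open>The constant is \<open>201/200 * 2 / (3 * 200) = 0.00335\<close>:
    \<open>201/200\<close> comes from \<open>gam\<close>, 2 from
    \<open>3/2 * t \<le> 2 * (NS * X)\<close>, 3 from the bound on \<open>cond2 A\<close> and 200
    from that on \<open>C\<close>. The factor \<open>1 / sqrt n\<close> later cancels the
    \<open>sqrt n\<close> in the Frobenius bound of \<open>?Z\<close>.\<close>
  define \<delta> where "\<delta> = 335 / 100000 / sqrt (real n)"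
  have n1: "1 \<le> sqrt (real n)" using sizes by simp
  have \<delta>1: "0 \<le> \<delta>" "\<delta> \<le> 335 / 100000"
    using n1 by (auto simp: \<delta>_def divide_le_eq)
  have "real n * 1 * u \<le> real n * real n * u"
    using rounding sizes by (intro mult_right_mono mult_left_mono) auto
  then have nu': "real n * u < 1 / 201" using nu by (simp add: power2_eq_square)
  have gn0: "0 \<le> gam u CARD('n)" using nu' rounding dims by (simp add: gam_def)
  have gn: "gam u CARD('n) \<le> 201 / 200 * (real n * u)"
  proof -
    have "real n * u * 1 \<le> real n * u * (201 / 200 * (1 - real n * u))"
      using nu' rounding by (intro mult_left_mono) auto
    then show ?thesis using nu' unfolding gam_def dims(3)[symmetric]
      by (simp add: pos_divide_le_eq algebra_simps)
  qed
  have "norm Rhat \<le> sqrt (real CARD('n)) * (\<sigma> * t * \<beta>)"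
  proof (rule frobenius_le_sqrt_spectral)
    show "norm (Rhat *v x) \<le> \<sigma> * t * \<beta> * norm x" for x
      using order_trans[OF Rup mult_left_mono[OF Aup], of x] \<sigma> t0 by (simp add: mult.assoc)
  qed (use \<sigma> t0 \<beta> in simp)
  then have nR: "norm Rhat \<le> sqrt (real n) * (\<sigma> * t * \<beta>)" using dims by simp
  have "gam u CARD('n) * norm Rhat * (3 / (2 * \<sigma> * \<alpha>))
      \<le> gam u CARD('n) * (sqrt (real n) * (\<sigma> * t * \<beta>)) * (3 / (2 * \<sigma> * \<alpha>))"
    using gn0 nR \<sigma> \<alpha> by (intro mult_right_mono mult_left_mono) auto
  also have "\<dots> = gam u CARD('n) * sqrt (real n) * (3/2 * t * (\<beta> / \<alpha>))"
    using \<sigma> \<alpha> by (simp add: field_simps)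
  also have "\<dots> \<le> gam u CARD('n) * sqrt (real n) * (2 * ((NS * X) * (\<beta> / \<alpha>)))"
  proof -
    \<comment> \<open>\<open>3/2 * t = 3/2 * \<kappa> + 1/2 \<le> 2 * \<kappa>\<close> because
      \<open>1 \<le> \<kappa>\<close>.\<close>
    have "3/2 * t \<le> 2 * (NS * X)" using \<kappa>1 \<kappa>K by (simp add: t_def)
    then have "3/2 * t * (\<beta> / \<alpha>) \<le> 2 * (NS * X) * (\<beta> / \<alpha>)"
      by (rule mult_right_mono) (use \<beta> \<alpha> in simp)
    then show ?thesis using gn0 by (intro mult_left_mono) auto
  qed
  also have "\<dots> \<le> 201 / 200 * (real n * u) * sqrt (real n) * (2 * (1 / (3 * (200 * (real n)\<^sup>2 * u))))"
  proof (intro mult_mono gn)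
    \<comment> \<open>With \<open>C\<close> replaced by its lower bound, the round-off
      \<open>u\<close> cancels against the one in the bound of \<open>gam\<close>.\<close>
    have "1 / (3 * C) \<le> 1 / (3 * (200 * (real n)\<^sup>2 * u))"
      using C n0 rounding(1) by (intro frac_le) (simp_all add: mult_ac)
    with CK show "(NS * X) * (\<beta> / \<alpha>) \<le> 1 / (3 * (200 * (real n)\<^sup>2 * u))" by linarith
  qed (use gn0 rounding \<beta> \<alpha> K0 in auto)
  also have "\<dots> = 335 / 100000 * (sqrt (real n) / real n)"
    using n0 rounding by (simp add: field_simps power2_eq_square)
  also have "\<dots> = \<delta>" using n0 by (simp add: \<delta>_def field_simps)
  finally have d: "gam u CARD('n) * norm Rhat * (3 / (2 * \<sigma> * \<alpha>)) \<le> \<delta>" .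

  have "norm (Yhat - ?Z) \<le> \<delta> / (1 - \<delta>) * norm ?Z"
    by (rule forward_substitution_error[OF Yhat inv gn0 H _ d]) (use \<sigma> \<alpha> \<delta>1 in auto)
  also have "\<dots> \<le> \<delta> / (1 - \<delta>) * (sqrt (real CARD('n)) * (3/2 / \<sigma>))"
    using \<delta>1 \<sigma> by (intro mult_left_mono frobenius_le_sqrt_spectral[OF Zup]) auto
  also have "\<dots> = (\<delta> * sqrt (real n)) / (1 - \<delta>) * (3/2 / \<sigma>)" using dims by simp
  also have "\<dots> = 335 / 100000 / (1 - \<delta>) * (3/2 / \<sigma>)" using n0 by (simp add: \<delta>_def)
  \<comment> \<open>\<open>0.00335 / (1 - 0.00335) < 0.00337\<close>, which explains the value of
    \<epsilon>.\<close>
  also have "\<dots> \<le> \<epsilon> * (3/2 / \<sigma>)"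
    using \<delta>1 \<sigma> by (intro mult_right_mono) (auto simp: \<epsilon>_def pos_divide_le_eq)
  finally have D: "norm (Yhat - ?Z) \<le> \<epsilon> * (3/2 / \<sigma>)" .
  have Dv: "norm (Yhat *v y - ?Z *v y) \<le> \<epsilon> * (3/2 / \<sigma>) * norm y" for y
    using norm_matrix_vector_le_frobenius[of "Yhat - ?Z" y] mult_right_mono[OF D, of "norm y"]
    by (simp add: matrix_vector_mult_diff_rdistrib)

  note ratio = ratio_bound[OF \<kappa>1 \<kappa>49 \<epsilon>_def, folded t_def]
  have "cond2 Yhat \<le> ereal (((1 + \<epsilon>) * (3/2)) / \<sigma> / ((1 / t - \<epsilon> * (3/2)) / \<sigma>))"
  proof (rule cond2_le[OF le_m])
    show "0 < (1 / t - \<epsilon> * (3/2)) / \<sigma>" using ratio \<sigma> by simp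
    fix y
    show "(1 / t - \<epsilon> * (3/2)) / \<sigma> * norm y \<le> norm (Yhat *v y)"
      using Zlo[of y] Dv[of y] norm_triangle_sub[of "?Z *v y" "Yhat *v y"]
      by (simp add: norm_minus_commute diff_divide_distrib left_diff_distrib)
    show "norm (Yhat *v y) \<le> ((1 + \<epsilon>) * (3/2)) / \<sigma> * norm y"
      using Zup[of y] Dv[of y] norm_triangle_sub[of "Yhat *v y" "?Z *v y"]
      by (simp add: add_divide_distrib distrib_right)
  qed
  also have "\<dots> \<le> ereal (4 * \<kappa> + 1)" using ratio \<sigma> by simp
  finally show ?thesis using M(3) by simp
qed

end
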